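(* Let $p$ be a prime and let $f(x)=\sum_{m=0}^{\infty}B_m\chi(m,x):\mathbb{Z}_p\to\mathbb{Z}_p$ be a 1-Lipschitz function (in van der Put expansion) satisfying: (1) $B_0\equiv s\pmod p$ for some integer $0<s<p$; (2) for this $s$, $\sum_{m=0}^{p-1}B_m\equiv ps+\tfrac12(p-1)p\pmod{p^2}$; (3) $\sum_{m=p}^{p^2-1}B_m\equiv4\pmod{2^3}$ if $p=2$, and $\sum_{m=p}^{p^2-1}B_m\equiv0\pmod{p^3}$ if $p>2$; (4) $B_m\equiv q(m)\pmod{p^{\lfloor\log_p m\rfloor+1}}$ for all $m\ge p$; (5) $\sum_{m=p^{n-1}}^{p^n-1}B_m\equiv0\pmod{p^{n+1}}$ for all $n\ge3$; and in addition $B_m\equiv B_0+m\pmod p$ for $0<m<p$. Then $f$ is ergodic.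
   Context: $\mathbb{Z}_p$ is the ring of $p$-adic integers with absolute value $|x|_p=p^{-\mathrm{ord}(x)}$ and normalized Haar measure $\mu_p$. A function $f:\mathbb{Z}_p\to\mathbb{Z}_p$ is 1-Lipschitz if $|f(x)-f(y)|_p\le|x-y|_p$ for all $x,y$; measure-preserving if $\mu_p(f^{-1}(S))=\mu_p(S)$ for every measurable $S$; ergodic if it is measure-preserving and every measurable $S$ with $f^{-1}(S)=S$ has $\mu_p(S)\in\{0,1\}$. For an integer $m>0$ with base-$p$ expansion $m=m_0+m_1p+\dots+m_sp^s$ ($0\le m_i\le p-1$, $m_s\ne0$), put $q(m)=m_sp^s$. The van der Put basis is: for $m>0$, $\chi(m,x)=1$ if $|x-m|_p\le p^{-\lfloor\log_p m\rfloor-1}$ and $0$ otherwise; $\chi(0,x)=1$ if $|x|_p\le p^{-1}$ and $0$ otherwise. Every continuous $f:\mathbb{Z}_p\to\mathbb{Z}_p$ has a unique expansion $f(x)=\sum_{m\ge0}B_m\chi(m,x)$ with $B_m\in\mathbb{Z}_p$, where $B_m=f(m)$ for $0\le m\le p-1$ and $B_m=f(m)-f(m-q(m))$ for $m\ge p$. *)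

theory Defs
  imports "HOL-Probability.Probability" "Berlekamp_Zassenhaus.Finite_Field"
begin

section \<open>The ring of p-adic integers\<close>

text \<open>
  The prime p is carried by a type parameter of class \<^class>\<open>prime_card\<close>, p being its
  cardinality. The p-adic integers are the inverse limit of the rings of integers modulo p^n;
  \<open>residue x n\<close> is the representative of x modulo p^n in the interval from 0 to p^n - 1.
\<close>

typedef ('p::prime_card) padic_int =
  "{x :: nat \<Rightarrow> int. \<forall>n. 0 \<le> x n \<and> x n < int CARD('p) ^ n \<and>
      x (Suc n) mod int CARD('p) ^ n = x n}"
  morphisms residue Abs_padic_int
proof -
  have "CARD('p) > 0" using prime_card[where 'a='p] prime_gt_0_nat by blast
  then show ?thesis by (intro exI[of _ "\<lambda>_. 0"]) simp
qed

setup_lifting type_definition_padic_int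

lemma prime_card_gt_1: "int CARD('p::prime_card) > 1"
  using prime_card[where 'a='p] prime_gt_1_nat by fastforce

lemma prime_card_power_pos: "int CARD('p::prime_card) ^ n > 0"
  using prime_card_gt_1[where 'p='p] by simp

lemma padic_coherent_aux:
  fixes a :: int
  assumes "p > 0"
  shows "(a mod p ^ Suc n) mod p ^ n = a mod p ^ n"
  by (rule mod_mod_cancel) (simp add: le_imp_power_dvd)

instantiation padic_int :: (prime_card) comm_ring_1
begin

lift_definition zero_padic_int :: "'a padic_int" is "\<lambda>n. 0 mod int CARD('a) ^ n"
  using prime_card_power_pos[where 'p='a] by simp

lift_definition one_padic_int :: "'a padic_int" is "\<lambda>n. 1 mod int CARD('a) ^ n"
  using prime_card_power_pos[where 'p='a] prime_card_gt_1[where 'p='a]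
  by (simp only: padic_coherent_aux pos_mod_sign pos_mod_bound)

lift_definition plus_padic_int :: "'a padic_int \<Rightarrow> 'a padic_int \<Rightarrow> 'a padic_int"
  is "\<lambda>x y n. (x n + y n) mod int CARD('a) ^ n"
proof -
  fix x y :: "nat \<Rightarrow> int" and n
  let ?p = "int CARD('a)"
  assume x: "\<And>n. 0 \<le> x n \<and> x n < ?p ^ n \<and> x (Suc n) mod ?p ^ n = x n"
    and y: "\<And>n. 0 \<le> y n \<and> y n < ?p ^ n \<and> y (Suc n) mod ?p ^ n = y n"
  have "(x (Suc n) + y (Suc n)) mod ?p ^ Suc n mod ?p ^ n = (x n + y n) mod ?p ^ n"
  proof -
    have "(x (Suc n) + y (Suc n)) mod ?p ^ Suc n mod ?p ^ n = (x (Suc n) + y (Suc n)) mod ?p ^ n"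
      using prime_card_gt_1[where 'p='a] by (intro padic_coherent_aux) simp
    also have "\<dots> = (x (Suc n) mod ?p ^ n + y (Suc n) mod ?p ^ n) mod ?p ^ n"
      by (simp add: mod_simps)
    finally show ?thesis using x y by simp
  qed
  then show "0 \<le> (x n + y n) mod ?p ^ n \<and> (x n + y n) mod ?p ^ n < ?p ^ n \<and>
      (x (Suc n) + y (Suc n)) mod ?p ^ Suc n mod ?p ^ n = (x n + y n) mod ?p ^ n"
    using prime_card_power_pos[where 'p='a] by simp
qed

lift_definition uminus_padic_int :: "'a padic_int \<Rightarrow> 'a padic_int"
  is "\<lambda>x n. (- x n) mod int CARD('a) ^ n"
proof -
  fix x :: "nat \<Rightarrow> int" and n
  let ?p = "int CARD('a)"
  assume x: "\<And>n. 0 \<le> x n \<and> x n < ?p ^ n \<and> x (Suc n) mod ?p ^ n = x n"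
  have "(- x (Suc n)) mod ?p ^ Suc n mod ?p ^ n = (- x n) mod ?p ^ n"
  proof -
    have "(- x (Suc n)) mod ?p ^ Suc n mod ?p ^ n = (- x (Suc n)) mod ?p ^ n"
      using prime_card_gt_1[where 'p='a] by (intro padic_coherent_aux) simp
    also have "\<dots> = (- (x (Suc n) mod ?p ^ n)) mod ?p ^ n"
      by (simp add: mod_simps)
    finally show ?thesis using x by simp
  qed
  then show "0 \<le> (- x n) mod ?p ^ n \<and> (- x n) mod ?p ^ n < ?p ^ n \<and>
      (- x (Suc n)) mod ?p ^ Suc n mod ?p ^ n = (- x n) mod ?p ^ n"
    using prime_card_power_pos[where 'p='a] by simp
qed

lift_definition times_padic_int :: "'a padic_int \<Rightarrow> 'a padic_int \<Rightarrow> 'a padic_int"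
  is "\<lambda>x y n. (x n * y n) mod int CARD('a) ^ n"
proof -
  fix x y :: "nat \<Rightarrow> int" and n
  let ?p = "int CARD('a)"
  assume x: "\<And>n. 0 \<le> x n \<and> x n < ?p ^ n \<and> x (Suc n) mod ?p ^ n = x n"
    and y: "\<And>n. 0 \<le> y n \<and> y n < ?p ^ n \<and> y (Suc n) mod ?p ^ n = y n"
  have "(x (Suc n) * y (Suc n)) mod ?p ^ Suc n mod ?p ^ n = (x n * y n) mod ?p ^ n"
  proof -
    have "(x (Suc n) * y (Suc n)) mod ?p ^ Suc n mod ?p ^ n = (x (Suc n) * y (Suc n)) mod ?p ^ n"
      using prime_card_gt_1[where 'p='a] by (intro padic_coherent_aux) simp
    also have "\<dots> = ((x (Suc n) mod ?p ^ n) * (y (Suc n) mod ?p ^ n)) mod ?p ^ n"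
      by (simp add: mod_simps)
    finally show ?thesis using x y by simp
  qed
  then show "0 \<le> (x n * y n) mod ?p ^ n \<and> (x n * y n) mod ?p ^ n < ?p ^ n \<and>
      (x (Suc n) * y (Suc n)) mod ?p ^ Suc n mod ?p ^ n = (x n * y n) mod ?p ^ n"
    using prime_card_power_pos[where 'p='a] by simp
qed

definition minus_padic_int :: "'a padic_int \<Rightarrow> 'a padic_int \<Rightarrow> 'a padic_int" where
  "minus_padic_int x y = x + - y"

instance
proof
  fix a b c :: "'a padic_int"
  show "a * b * c = a * (b * c)" by transfer (auto simp: mod_simps mult_ac)
  show "a * b = b * a" by transfer (auto simp: mod_simps mult_ac)
  show "1 * a = a" by transfer (auto simp: fun_eq_iff mod_simps)
  show "(a + b) * c = a * c + b * c" by transfer (auto simp: fun_eq_iff mod_simps algebra_simps)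
  show "a + b + c = a + (b + c)" by transfer (auto simp: mod_simps add_ac)
  show "a + b = b + a" by transfer (auto simp: add_ac)
  show "0 + a = a" by transfer (auto simp: fun_eq_iff mod_simps)
  show "- a + a = 0" by transfer (auto simp: fun_eq_iff mod_simps)
  show "a - b = a + - b" by (simp add: minus_padic_int_def)
  show "(0 :: 'a padic_int) \<noteq> 1"
    using prime_card_gt_1[where 'p='a]
    by transfer (auto simp: fun_eq_iff intro!: exI[of _ "Suc 0"])
qed

end

lemma residue_bounds:
  fixes x :: "'p::prime_card padic_int"
  shows "0 \<le> residue x n" "residue x n < int CARD('p) ^ n"
  using residue[of x] by auto

lemma residue_mod:
  fixes x :: "'p::prime_card padic_int"
  assumes "n \<le> m"
  shows "residue x m mod int CARD('p) ^ n = residue x n"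
  using assms
proof (induction m rule: dec_induct)
  case base
  then show ?case using residue_bounds[of x n] by simp
next
  case (step m)
  have "residue x (Suc m) mod int CARD('p) ^ n
      = residue x (Suc m) mod int CARD('p) ^ m mod int CARD('p) ^ n"
    using step by (intro mod_mod_cancel[symmetric]) (simp add: le_imp_power_dvd)
  also have "residue x (Suc m) mod int CARD('p) ^ m = residue x m" using residue[of x] by auto
  finally show ?case using step by simp
qed

lemma padic_int_eqI: "(\<And>n. residue x n = residue y n) \<Longrightarrow> x = y"
  by (metis residue_inject ext)

lemma residue_zero [simp]: "residue 0 n = 0"
  by (simp add: zero_padic_int.rep_eq)

lemma residue_add:
  "residue (x + y :: 'p::prime_card padic_int) n = (residue x n + residue y n) mod int CARD('p) ^ n"
  by (simp add: plus_padic_int.rep_eq)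

lemma residue_uminus:
  "residue (- x :: 'p::prime_card padic_int) n = (- residue x n) mod int CARD('p) ^ n"
  by (simp add: uminus_padic_int.rep_eq)

lemma residue_diff:
  "residue (x - y :: 'p::prime_card padic_int) n = (residue x n - residue y n) mod int CARD('p) ^ n"
  unfolding minus_padic_int_def residue_add residue_uminus by (simp add: mod_simps)

lemma residue_mult:
  "residue (x * y :: 'p::prime_card padic_int) n = (residue x n * residue y n) mod int CARD('p) ^ n"
  by (simp add: times_padic_int.rep_eq)

lemma residue_of_nat:
  "residue (of_nat k :: 'p::prime_card padic_int) n = int k mod int CARD('p) ^ n"
  by (induction k) (simp_all add: residue_add one_padic_int.rep_eq mod_simps)

lemma residue_eq_iff:
  "residue x n = residue y n \<longleftrightarrow> residue (x - y :: 'p::prime_card padic_int) n = 0"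
proof -
  have "residue x n = residue y n \<longleftrightarrow>
      residue x n mod int CARD('p) ^ n = residue y n mod int CARD('p) ^ n"
    using residue_bounds[of x n] residue_bounds[of y n] by simp
  then show ?thesis by (simp add: residue_diff mod_eq_dvd_iff mod_eq_0_iff_dvd)
qed

lemma int_div_less:
  fixes a c n :: int
  assumes "0 < c" "a < n * c"
  shows "a div c < n"
proof (rule ccontr)
  assume "\<not> a div c < n"
  then have "n * c \<le> a div c * c" using assms by (intro mult_right_mono) auto
  also have "\<dots> \<le> a" using assms pos_mod_sign[of c a] div_mult_mod_eq[of a c] by linarith
  finally show False using assms by simp
qed

lemma padic_power_dvd_iff:
  fixes x :: "'p::prime_card padic_int"
  shows "of_nat CARD('p) ^ k dvd x \<longleftrightarrow> residue x k = 0"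
proof
  assume "of_nat CARD('p) ^ k dvd x"
  then obtain y where y: "x = of_nat (CARD('p) ^ k) * y" by auto
  show "residue x k = 0" unfolding y residue_mult residue_of_nat by (simp add: mod_simps)
next
  let ?p = "int CARD('p)"
  assume x0: "residue x k = 0"
  define y where "y = (\<lambda>n. residue x (n + k) div ?p ^ k)"
  have pp: "?p ^ n > 0" for n by (rule prime_card_power_pos)
  have "0 \<le> y n \<and> y n < ?p ^ n \<and> y (Suc n) mod ?p ^ n = y n" for n
  proof (intro conjI)
    show "0 \<le> y n"
      unfolding y_def using residue_bounds(1)[of x "n + k"] pp[of k]
      by (simp add: pos_imp_zdiv_nonneg_iff)
    show "y n < ?p ^ n"
      unfolding y_def using residue_bounds(2)[of x "n + k"] pp[of k]
      by (intro int_div_less) (simp_all add: power_add)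
    have d: "?p ^ k * (residue x (n + k) div ?p ^ k) = residue x (n + k)" for n
      using residue_mod[of k "n + k" x] x0 by (simp add: mod_eq_0_iff_dvd)
    have "?p ^ k * (y (Suc n) mod ?p ^ n) = (?p ^ k * y (Suc n)) mod (?p ^ k * ?p ^ n)"
      by (rule mult_mod_right)
    also have "\<dots> = residue x (Suc n + k) mod ?p ^ (n + k)"
      unfolding y_def d power_add by (simp only: mult.commute)
    also have "\<dots> = residue x (n + k)" by (rule residue_mod) simp
    also have "\<dots> = ?p ^ k * y n" using d[of n] by (simp add: y_def)
    finally show "y (Suc n) mod ?p ^ n = y n" using pp[of k] by simp
  qed
  then have r: "residue (Abs_padic_int y :: 'p padic_int) = y"
    by (intro Abs_padic_int_inverse) auto
  have "x = of_nat (CARD('p) ^ k) * Abs_padic_int y"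
  proof (rule padic_int_eqI)
    fix n
    have "?p ^ k * y n = residue x (n + k)"
      using residue_mod[of k "n + k" x] x0 by (simp add: y_def mod_eq_0_iff_dvd)
    then have "residue x n = (?p ^ k * y n) mod ?p ^ n" using residue_mod[of n "n + k" x] by simp
    then show "residue x n = residue (of_nat (CARD('p) ^ k) * Abs_padic_int y :: 'p padic_int) n"
      unfolding residue_mult residue_of_nat r by (simp add: mod_simps)
  qed
  then show "of_nat CARD('p) ^ k dvd x" by simp
qed

definition padic_cong :: "'p::prime_card padic_int \<Rightarrow> 'p padic_int \<Rightarrow> nat \<Rightarrow> bool" where
  "padic_cong x y k \<longleftrightarrow> of_nat CARD('p) ^ k dvd x - y"


section \<open>Absolute value and metric\<close>

definition padic_ord :: "'p::prime_card padic_int \<Rightarrow> nat" where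
  "padic_ord x = (GREATEST k. of_nat CARD('p) ^ k dvd x)"

definition padic_abs :: "'p::prime_card padic_int \<Rightarrow> real" where
  "padic_abs x = (if x = 0 then 0 else real CARD('p) powi (- int (padic_ord x)))"

lemma padic_ord_ge_iff:
  fixes x :: "'p::prime_card padic_int"
  assumes "x \<noteq> 0"
  shows "k \<le> padic_ord x \<longleftrightarrow> residue x k = 0"
proof -
  obtain m where m: "residue x m \<noteq> 0"
    using assms padic_int_eqI[of x 0] unfolding residue_zero by blast
  have down: "residue x j = 0" if "residue x i = 0" "j \<le> i" for i j
    using residue_mod[OF that(2), of x] that by simp
  have bd: "k \<le> m" if "residue x k = 0" for k
  proof (rule ccontr)
    assume "\<not> k \<le> m"
    with down[OF that, of m] m show False by simp
  qed
  have o: "padic_ord x = (GREATEST k. residue x k = 0)"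
    by (simp add: padic_ord_def padic_power_dvd_iff)
  have r0: "residue x 0 = 0" using residue_bounds[of x 0] by simp
  have "residue x (padic_ord x) = 0"
    unfolding o using GreatestI_nat[of "\<lambda>k. residue x k = 0", OF r0 bd] .
  moreover have "k \<le> padic_ord x" if "residue x k = 0"
    unfolding o using Greatest_le_nat[of "\<lambda>k. residue x k = 0", OF that bd] .
  ultimately show ?thesis using down[of "padic_ord x" k] by auto
qed

lemma powi_le_iff:
  fixes a :: real
  assumes "a > 1"
  shows "a powi m \<le> a powi n \<longleftrightarrow> m \<le> n"
proof
  assume "a powi m \<le> a powi n"
  then show "m \<le> n" using assms power_int_strict_increasing[of n m a] by (cases "n < m") auto
qed (use assms in \<open>auto intro: power_int_increasing\<close>)

lemma padic_abs_le_iff: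
  fixes x :: "'p::prime_card padic_int"
  shows "padic_abs x \<le> real CARD('p) powi (- int k) \<longleftrightarrow> residue x k = 0"
proof (cases "x = 0")
  case False
  have "real CARD('p) > 1" using prime_card_gt_1[where 'p='p] by simp
  then have "padic_abs x \<le> real CARD('p) powi (- int k) \<longleftrightarrow> k \<le> padic_ord x"
    using False by (simp add: padic_abs_def powi_le_iff)
  then show ?thesis using padic_ord_ge_iff[OF False] by simp
qed (simp add: padic_abs_def)

lemma padic_abs_ultrametric:
  fixes x y :: "'p::prime_card padic_int"
  shows "padic_abs (x + y) \<le> max (padic_abs x) (padic_abs y)"
proof (cases "x = 0 \<or> y = 0")
  case True
  then show ?thesis by auto
next
  case False
  define k where "k = min (padic_ord x) (padic_ord y)"
  have "residue x k = 0" "residue y k = 0"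
    using False padic_ord_ge_iff[of x k] padic_ord_ge_iff[of y k] unfolding k_def by auto
  then have "padic_abs (x + y) \<le> real CARD('p) powi (- int k)"
    by (simp add: padic_abs_le_iff residue_add)
  also have "\<dots> \<le> max (padic_abs x) (padic_abs y)"
    using False unfolding padic_abs_def k_def by (simp split: split_min)
  finally show ?thesis .
qed

lemma padic_abs_nonneg: "padic_abs (x :: 'p::prime_card padic_int) \<ge> 0"
  by (simp add: padic_abs_def)

lemma padic_abs_eq_0_iff: "padic_abs (x :: 'p::prime_card padic_int) = 0 \<longleftrightarrow> x = 0"
  using prime_card_gt_1[where 'p='p] by (auto simp: padic_abs_def)

lemma padic_abs_minus_commute: "padic_abs (x - y :: 'p::prime_card padic_int) = padic_abs (y - x)"
proof -
  have "of_nat CARD('p) ^ k dvd x - y \<longleftrightarrow> of_nat CARD('p) ^ k dvd y - x" for k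
    by (subst dvd_minus_iff[symmetric]) (simp only: minus_diff_eq)
  then show ?thesis by (auto simp: padic_abs_def padic_ord_def)
qed

instantiation padic_int :: (prime_card) metric_space
begin

definition dist_padic_int :: "'a padic_int \<Rightarrow> 'a padic_int \<Rightarrow> real" where
  "dist_padic_int x y = padic_abs (x - y)"

definition uniformity_padic_int :: "('a padic_int \<times> 'a padic_int) filter" where
  "uniformity_padic_int = (INF e\<in>{0 <..}. principal {(x, y). dist x y < e})"

definition open_padic_int :: "'a padic_int set \<Rightarrow> bool" where
  "open_padic_int U \<longleftrightarrow> (\<forall>x\<in>U. eventually (\<lambda>(x', y). x' = x \<longrightarrow> y \<in> U) uniformity)"

instance
proof
  fix x y z :: "'a padic_int"
  show "dist x y = 0 \<longleftrightarrow> x = y" by (simp add: dist_padic_int_def padic_abs_eq_0_iff)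
  have "dist x y \<le> max (padic_abs (x - z)) (padic_abs (z - y))"
    using padic_abs_ultrametric[of "x - z" "z - y"] by (simp add: dist_padic_int_def)
  then show "dist x y \<le> dist x z + dist y z"
    using padic_abs_nonneg[of "x - z"] padic_abs_nonneg[of "z - y"]
    by (simp add: dist_padic_int_def padic_abs_minus_commute[of z y])
qed (simp_all add: uniformity_padic_int_def open_padic_int_def)

end


section \<open>Haar measure\<close>

definition normalized_haar :: "'p::prime_card padic_int measure \<Rightarrow> bool" where
  "normalized_haar M \<longleftrightarrow> sets M = sets borel \<and> emeasure M UNIV = 1 \<and>
     (\<forall>a. \<forall>S\<in>sets borel. emeasure M ((\<lambda>x. a + x) ` S) = emeasure M S)"

definition padic_haar :: "'p::prime_card padic_int measure" where
  "padic_haar = (THE M. normalized_haar M)"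

definition residue_class :: "nat \<Rightarrow> int \<Rightarrow> 'p::prime_card padic_int set" where
  "residue_class n b = {x. residue x n = b}"

lemma open_contains_residue_class:
  fixes U :: "'p::prime_card padic_int set"
  assumes "open U" "x \<in> U"
  obtains n where "residue_class n (residue x n) \<subseteq> U"
proof -
  obtain e where e: "e > 0" "\<And>y. dist y x < e \<Longrightarrow> y \<in> U" using assms by (meson open_dist)
  have p: "real CARD('p) > 1" using prime_card_gt_1[where 'p='p] by simp
  obtain n where "(1 / real CARD('p)) ^ n < e"
    using real_arch_pow_inv[of e "1 / real CARD('p)"] e(1) p by auto
  then have n: "real CARD('p) powi (- int n) < e"
    by (simp add: power_int_minus power_inverse divide_inverse)
  have "residue_class n (residue x n) \<subseteq> U"
  proof
    fix y :: "'p padic_int"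
    assume "y \<in> residue_class n (residue x n)"
    then have "residue (y - x) n = 0" by (simp add: residue_class_def residue_eq_iff)
    then have "dist y x \<le> real CARD('p) powi (- int n)"
      by (simp add: dist_padic_int_def padic_abs_le_iff)
    with n e show "y \<in> U" by auto
  qed
  then show ?thesis by (rule that)
qed

lemma open_residue_class: "open (residue_class n b :: 'p::prime_card padic_int set)"
  unfolding open_dist
proof (intro ballI exI[of _ "real CARD('p) powi (- int n)"] conjI allI impI)
  fix x y :: "'p padic_int"
  show "real CARD('p) powi (- int n) > 0" using prime_card_gt_1[where 'p='p] by simp
  assume "x \<in> residue_class n b" "dist y x < real CARD('p) powi (- int n)"
  then show "y \<in> residue_class n b"
    using padic_abs_le_iff[of "y - x" n] by (auto simp: dist_padic_int_def residue_class_def residue_eq_iff)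
qed

lemma sets_residue_class:
  "residue_class n b \<in> sets (borel :: 'p::prime_card padic_int measure)"
  using open_residue_class by (rule borel_open)

lemma borel_padic_int:
  "sets (borel :: 'p::prime_card padic_int measure) =
     sigma_sets UNIV (range (\<lambda>(n, b). residue_class n b))"
proof -
  let ?E = "range (\<lambda>(n, b). residue_class n b) :: 'p padic_int set set"
  have sub: "U \<in> sigma_sets UNIV ?E" if U: "open U" for U
  proof -
    have "U = \<Union>{C \<in> ?E. C \<subseteq> U}"
    proof
      show "U \<subseteq> \<Union>{C \<in> ?E. C \<subseteq> U}"
      proof
        fix x assume "x \<in> U"
        then obtain n where "residue_class n (residue x n) \<subseteq> U"
          using open_contains_residue_class[OF U] by metis
        then show "x \<in> \<Union>{C \<in> ?E. C \<subseteq> U}"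
          by (intro UnionI[of "residue_class n (residue x n)"]) (auto simp: residue_class_def)
      qed
    qed auto
    moreover have "\<Union>{C \<in> ?E. C \<subseteq> U} \<in> sigma_sets UNIV ?E"
      by (rule sigma_sets_UNION) (auto intro: countable_subset[of _ ?E])
    ultimately show ?thesis by simp
  qed
  have "sets (borel :: 'p padic_int measure) = sigma_sets UNIV {S. open S}"
    by (simp add: borel_def)
  also have "\<dots> = sigma_sets UNIV ?E"
    by (rule sigma_sets_eqI) (auto simp: sub open_residue_class)
  finally show ?thesis .
qed

lemma padic_measure_eqI:
  fixes M N :: "'p::prime_card padic_int measure"
  assumes "sets M = sets borel" "sets N = sets borel" "emeasure M UNIV \<noteq> \<infinity>"
    and eq: "\<And>n b. 0 \<le> b \<Longrightarrow> b < int CARD('p) ^ n \<Longrightarrow>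
      emeasure M (residue_class n b) = emeasure N (residue_class n b)"
  shows "M = N"
proof (rule measure_eqI_generator_eq)
  let ?E = "range (\<lambda>(n, b). residue_class n b) :: 'p padic_int set set"
  have inter: "residue_class n b \<inter> residue_class m c \<in> ?E" if "n \<le> m" for n m b c
  proof (cases "c mod int CARD('p) ^ n = b")
    case True
    then have "residue_class n b \<inter> residue_class m c = (residue_class m c :: 'p padic_int set)"
      using residue_mod[OF that, where 'p='p] by (auto simp: residue_class_def)
    then show ?thesis by auto
  next
    case False
    have "residue x n \<noteq> -1" for x :: "'p padic_int" using residue_bounds(1)[of x n] by linarith
    then have "residue_class n b \<inter> residue_class m c = (residue_class n (-1) :: 'p padic_int set)"
      using residue_mod[OF that, where 'p='p] False by (auto simp: residue_class_def)
    then show ?thesis by auto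
  qed
  show "Int_stable ?E"
    unfolding Int_stable_def using inter by (auto, metis inter Int_commute nle_le)
  show "emeasure M X = emeasure N X" if "X \<in> ?E" for X
  proof -
    obtain n b where X: "X = residue_class n b" using \<open>X \<in> ?E\<close> by auto
    show ?thesis
    proof (cases "0 \<le> b \<and> b < int CARD('p) ^ n")
      case False
      then have "X = {}" unfolding X residue_class_def using residue_bounds by blast
      then show ?thesis by simp
    qed (simp add: X eq)
  qed
  show "sets M = sigma_sets UNIV ?E" "sets N = sigma_sets UNIV ?E"
    using assms borel_padic_int by auto
  have "residue x 0 = 0" for x :: "'p padic_int" using residue_bounds[of x 0] by simp
  then have "residue_class 0 0 = (UNIV :: 'p padic_int set)" by (simp add: residue_class_def)
  then have "UNIV \<in> ?E" by (metis (mono_tags, lifting) case_prod_conv rangeI)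
  then show "range (\<lambda>_::nat. UNIV) \<subseteq> ?E" by auto
qed (use assms in auto)

lemma normalized_haar_residue_class:
  fixes M :: "'p::prime_card padic_int measure"
  assumes M: "normalized_haar M" and b: "0 \<le> b" "b < int CARD('p) ^ n"
  shows "emeasure M (residue_class n b) = 1 / ennreal (real CARD('p) ^ n)"
proof -
  let ?P = "int CARD('p) ^ n"
  let ?C = "residue_class n :: int \<Rightarrow> 'p padic_int set"
  have sM: "sets M = sets borel" and M1: "emeasure M UNIV = 1"
    and inv: "\<And>a S. S \<in> sets borel \<Longrightarrow> emeasure M ((\<lambda>x. a + x) ` S) = emeasure M S"
    using M unfolding normalized_haar_def by blast+
  have sets: "?C c \<in> sets M" for c unfolding sM by (rule sets_residue_class)
  have trans: "emeasure M (?C c) = emeasure M (?C 0)" if c: "0 \<le> c" "c < ?P" for c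
  proof -
    define a :: "'p padic_int" where "a = of_nat (nat c)"
    have ra: "residue a n = c" unfolding a_def residue_of_nat using c by simp
    have "?C c = (\<lambda>x. a + x) ` ?C 0"
    proof
      show "?C c \<subseteq> (\<lambda>x. a + x) ` ?C 0"
      proof
        fix x assume "x \<in> ?C c"
        then have "x - a \<in> ?C 0" using ra by (simp add: residue_class_def residue_diff)
        then show "x \<in> (\<lambda>x. a + x) ` ?C 0" by (intro image_eqI[of _ _ "x - a"]) auto
      qed
      show "(\<lambda>x. a + x) ` ?C 0 \<subseteq> ?C c"
        using c ra by (auto simp: residue_class_def residue_add)
    qed
    then show ?thesis by (simp only: inv[OF sets_residue_class])
  qed
  have "(\<Union>c\<in>{0..<?P}. ?C c) = UNIV" using residue_bounds by (auto simp: residue_class_def)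
  then have "1 = emeasure M (\<Union>c\<in>{0..<?P}. ?C c)" by (simp only: M1)
  also have "\<dots> = (\<Sum>c\<in>{0..<?P}. emeasure M (?C c))"
  proof (rule sum_emeasure[symmetric])
    show "?C ` {0..<?P} \<subseteq> sets M" using sets by blast
  qed (auto simp: disjoint_family_on_def residue_class_def)
  also have "\<dots> = (\<Sum>c\<in>{0..<?P}. emeasure M (?C 0))" 
    by (rule sum.cong[OF refl], rule trans) simp_all
  also have "\<dots> = ennreal (real CARD('p) ^ n) * emeasure M (?C 0)"
    by (simp add: nat_power_eq ennreal_of_nat_eq_real_of_nat)
  finally have "ennreal (real CARD('p) ^ n) * emeasure M (?C 0) = 1" by simp
  then have one: "emeasure M (?C 0) * ennreal (real CARD('p) ^ n) = 1"
    by (simp only: mult.commute)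
  have pos: "real CARD('p) ^ n > 0" using prime_card_gt_1[where 'p='p] by simp
  have "emeasure M (?C 0) = emeasure M (?C 0) * ennreal (real CARD('p) ^ n) / ennreal (real CARD('p) ^ n)"
    using pos by (intro ennreal_mult_divide_eq[symmetric]) auto
  then have "emeasure M (?C 0) = 1 / ennreal (real CARD('p) ^ n)" unfolding one .
  then show ?thesis using trans[OF b] by simp
qed

lemma residue_sum_digits:
  fixes d :: "nat \<Rightarrow> nat" and b :: int and p :: nat
  assumes p: "p > 0" and b: "0 \<le> b" "b < int p ^ n"
  shows "(\<Sum>i<n. int (d i mod p) * int p ^ i) = b
    \<longleftrightarrow> (\<forall>i<n. int (d i mod p) = b div int p ^ i mod int p)"
  using b
proof (induction n arbitrary: b)
  case (Suc n)
  let ?S = "\<Sum>i<n. int (d i mod p) * int p ^ i"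
  have pn: "int p ^ n > 0" using p by simp
  have S: "0 \<le> ?S \<and> ?S < int p ^ n"
  proof (induction n)
    case (Suc n)
    have "int (d n mod p) \<le> int p - 1"
      using mod_less_divisor[OF p, of "d n"] by linarith
    then have "int (d n mod p) * int p ^ n \<le> (int p - 1) * int p ^ n"
      by (intro mult_right_mono) auto
    with Suc show ?case by (simp add: algebra_simps)
  qed simp
  have "(\<Sum>i<Suc n. int (d i mod p) * int p ^ i) = b \<longleftrightarrow>
      ?S = b mod int p ^ n \<and> int (d n mod p) = b div int p ^ n"
  proof
    assume eq: "(\<Sum>i<Suc n. int (d i mod p) * int p ^ i) = b"
    then have b: "b = ?S + int (d n mod p) * int p ^ n" by simp
    have "b mod int p ^ n = ?S" unfolding b mod_mult_self1 using S by simp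
    moreover have "b div int p ^ n = int (d n mod p)"
    proof -
      have "b div int p ^ n = int (d n mod p) + ?S div int p ^ n"
        unfolding b using pn by (intro div_mult_self1) simp
      also have "?S div int p ^ n = 0" using S by (intro div_pos_pos_trivial) simp_all
      finally show ?thesis by simp
    qed
    ultimately show "?S = b mod int p ^ n \<and> int (d n mod p) = b div int p ^ n" by simp
  next
    assume "?S = b mod int p ^ n \<and> int (d n mod p) = b div int p ^ n"
    then show "(\<Sum>i<Suc n. int (d i mod p) * int p ^ i) = b"
      using mod_div_mult_eq[of b "int p ^ n"] by (simp only: sum.lessThan_Suc)
  qed
  moreover have "?S = b mod int p ^ n \<longleftrightarrow>
      (\<forall>i<n. int (d i mod p) = b mod int p ^ n div int p ^ i mod int p)"
    using pn by (intro Suc.IH) auto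
  moreover have "b mod int p ^ n div int p ^ i mod int p = b div int p ^ i mod int p"
    if "i < n" for i
  proof -
    have "int p ^ n = int p ^ i * int p ^ (n - i)" using that by (simp flip: power_add)
    then have "b mod int p ^ n div int p ^ i = b div int p ^ i mod int p ^ (n - i)"
      using p by (simp add: zmod_zmult2_eq)
    also have "\<dots> mod int p = b div int p ^ i mod int p"
      using that by (intro mod_mod_cancel) simp
    finally show ?thesis .
  qed
  moreover have "b div int p ^ n mod int p = b div int p ^ n"
  proof (rule mod_pos_pos_trivial)
    show "0 \<le> b div int p ^ n" using Suc.prems pn by (simp add: pos_imp_zdiv_nonneg_iff)
    show "b div int p ^ n < int p" using Suc.prems pn by (intro int_div_less) simp_all
  qed
  ultimately show ?case by (auto simp: less_Suc_eq)
qed auto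

text \<open>Existence: the Haar measure is the law of a p-adic integer with independent uniform digits.\<close>

lemma ex_normalized_haar: "\<exists>M :: 'p::prime_card padic_int measure. normalized_haar M"
proof -
  let ?p = "CARD('p)"
  have p: "?p > 0" using prime_card_gt_1[where 'p='p] by simp
  define D where "D = (\<lambda>_::nat. measure_pmf (pmf_of_set {..<?p}))"
  define g where "g = (\<lambda>(d::nat \<Rightarrow> nat) n. \<Sum>i<n. int (d i mod ?p) * int ?p ^ i)"
  define h where "h = (\<lambda>d. Abs_padic_int (g d) :: 'p padic_int)"
  interpret D: product_prob_space D UNIV
    unfolding D_def by standard
  have res: "residue (h d) = g d" for d
  proof -
    have bd: "0 \<le> g d n \<and> g d n < int ?p ^ n" for n
    proof (induction n)
      case (Suc n)
      have "int (d n mod ?p) \<le> int ?p - 1"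
        using mod_less_divisor[OF p, of "d n"] by linarith
      then have "int (d n mod ?p) * int ?p ^ n \<le> (int ?p - 1) * int ?p ^ n"
        by (intro mult_right_mono) auto
      with Suc show ?case by (simp add: g_def algebra_simps)
    qed (simp add: g_def)
    have "g d (Suc n) mod int ?p ^ n = g d n" for n
    proof -
      have "g d (Suc n) = g d n + int (d n mod ?p) * int ?p ^ n" by (simp add: g_def)
      then show ?thesis using bd[of n] by simp
    qed
    with bd show ?thesis unfolding h_def by (intro Abs_padic_int_inverse) auto
  qed
  define box where "box = (\<lambda>n b. prod_emb UNIV D {..<n}
    (Pi\<^sub>E {..<n} (\<lambda>i. {k. int (k mod ?p) = b div int ?p ^ i mod int ?p})))"
  have box: "h -` residue_class n b = box n b" if "0 \<le> b" "b < int ?p ^ n" for n b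
  proof -
    have "h -` residue_class n b = {d. \<forall>i<n. int (d i mod ?p) = b div int ?p ^ i mod int ?p}"
      unfolding residue_class_def vimage_def mem_Collect_eq res g_def residue_sum_digits[OF p that] ..
    also have "\<dots> = box n b"
    proof (rule Set.set_eqI)
      fix d
      have "space (D i) = UNIV" for i by (simp add: D_def)
      then show "d \<in> {d. \<forall>i<n. int (d i mod ?p) = b div int ?p ^ i mod int ?p} \<longleftrightarrow> d \<in> box n b"
        unfolding box_def prod_emb_iff PiE_iff by (simp only: mem_Collect_eq) auto
    qed
    finally show ?thesis .
  qed
  have empty: "h -` residue_class n b = {}" if "\<not> (0 \<le> b \<and> b < int ?p ^ n)" for n b
  proof -
    have "residue x n \<noteq> b" for x :: "'p padic_int" using that residue_bounds[of x n] by auto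
    then show ?thesis by (simp add: residue_class_def)
  qed
  have box_sets: "box n b \<in> sets (PiM UNIV D)" for n b
    unfolding box_def by (rule sets_PiM_I) (auto simp: D_def)
  have box_measure: "emeasure (PiM UNIV D) (box n b) = ennreal (1 / real ?p) ^ n" for n b
  proof -
    have "emeasure (D i) {k. int (k mod ?p) = b div int ?p ^ i mod int ?p}
        = ennreal (1 / real ?p)" for i
    proof -
      let ?c = "nat (b div int ?p ^ i mod int ?p)"
      have c: "0 \<le> b div int ?p ^ i mod int ?p" "b div int ?p ^ i mod int ?p < int ?p"
        using p by auto
      have "{..<?p} \<inter> {k. int (k mod ?p) = b div int ?p ^ i mod int ?p} = {?c}"
        using c by (auto simp: nat_less_iff)
      then show ?thesis
        using p unfolding D_def by (subst emeasure_pmf_of_set) (auto simp: lessThan_empty_iff)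
    qed
    then show ?thesis
      unfolding box_def by (subst D.emeasure_PiM_emb) (auto simp: D_def)
  qed
  have h: "h \<in> measurable (PiM UNIV D) borel"
  proof (rule measurable_sigma_sets[OF borel_padic_int])
    fix X :: "'p padic_int set" assume "X \<in> range (\<lambda>(n, b). residue_class n b)"
    then obtain n b where X: "X = residue_class n b" by auto
    have "h -` X \<in> sets (PiM UNIV D)"
      unfolding X by (cases "0 \<le> b \<and> b < int ?p ^ n") (simp_all add: box box_sets empty)
    then show "h -` X \<inter> space (PiM UNIV D) \<in> sets (PiM UNIV D)" by auto
  qed auto
  define M where "M = distr (PiM UNIV D) borel h"
  have sM: "sets M = sets borel" by (simp add: M_def)
  interpret M: prob_space M unfolding M_def by (rule D.prob_space_distr[OF h])
  have M1: "emeasure M UNIV = 1" using M.emeasure_space_1 by (simp add: M_def)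
  have Mb: "emeasure M (residue_class n b) = ennreal (1 / real ?p) ^ n"
    if "0 \<le> b" "b < int ?p ^ n" for n b
  proof -
    have "residue_class n b \<in> sets (borel :: 'p padic_int measure)" by (rule sets_residue_class)
    then have "emeasure M (residue_class n b)
        = emeasure (PiM UNIV D) (h -` residue_class n b \<inter> space (PiM UNIV D))"
      unfolding M_def by (rule emeasure_distr[OF h])
    also have "h -` residue_class n b \<inter> space (PiM UNIV D) = box n b"
      using box[OF that] by (simp add: space_PiM D_def)
    finally show ?thesis by (simp add: box_measure)
  qed
  have inv: "emeasure M ((\<lambda>x. a + x) ` S) = emeasure M S" if S: "S \<in> sets borel" for a S
  proof -
    have pre: "(\<lambda>x. x - a) -` residue_class n b
        = residue_class n ((b + residue a n) mod int ?p ^ n)" if "0 \<le> b" "b < int ?p ^ n" for n b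
    proof -
      have "(residue x n - residue a n) mod int ?p ^ n = b \<longleftrightarrow>
          residue x n = (b + residue a n) mod int ?p ^ n" for x :: "'p padic_int"
      proof
        assume "(residue x n - residue a n) mod int ?p ^ n = b"
        then have "(b + residue a n) mod int ?p ^ n
            = ((residue x n - residue a n) mod int ?p ^ n + residue a n) mod int ?p ^ n" by simp
        also have "\<dots> = residue x n mod int ?p ^ n" unfolding mod_add_left_eq by simp
        also have "\<dots> = residue x n" using residue_bounds[of x n] by (rule mod_pos_pos_trivial)
        finally show "residue x n = (b + residue a n) mod int ?p ^ n" ..
      next
        assume "residue x n = (b + residue a n) mod int ?p ^ n"
        then have "(residue x n - residue a n) mod int ?p ^ n
            = ((b + residue a n) mod int ?p ^ n - residue a n) mod int ?p ^ n" by simp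
        also have "\<dots> = b mod int ?p ^ n" unfolding mod_diff_left_eq by simp
        also have "\<dots> = b" using that by (rule mod_pos_pos_trivial)
        finally show "(residue x n - residue a n) mod int ?p ^ n = b" .
      qed
      then show ?thesis unfolding residue_class_def vimage_def mem_Collect_eq residue_diff by blast
    qed
    have "x - a - (y - a) = x - y" for x y :: "'p padic_int" by (simp add: algebra_simps)
    then have "continuous_on UNIV (\<lambda>x :: 'p padic_int. x - a)"
      by (auto simp: continuous_on_iff dist_padic_int_def)
    then have m: "(\<lambda>x. x - a) \<in> measurable M borel"
      by (simp add: measurable_cong_sets[OF sM refl] borel_measurable_continuous_onI)
    have sp: "space M = UNIV" by (simp add: M_def)
    have "distr M borel (\<lambda>x. x - a) = M"
    proof (rule padic_measure_eqI)
      interpret N: prob_space "distr M borel (\<lambda>x. x - a)" by (rule M.prob_space_distr[OF m])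
      show "emeasure (distr M borel (\<lambda>x. x - a)) UNIV \<noteq> \<infinity>"
        using N.emeasure_finite by simp
      fix n and b :: int assume b: "0 \<le> b" "b < int ?p ^ n"
      have "residue_class n b \<in> sets (borel :: 'p padic_int measure)" by (rule sets_residue_class)
      then have "emeasure (distr M borel (\<lambda>x. x - a)) (residue_class n b)
          = emeasure M (residue_class n ((b + residue a n) mod int ?p ^ n))"
        by (simp add: emeasure_distr[OF m] pre[OF b] sp)
      also have "\<dots> = emeasure M (residue_class n b)"
        using prime_card_power_pos[where 'p='p] by (subst Mb[OF b], intro Mb) simp_all
      finally show "emeasure (distr M borel (\<lambda>x. x - a)) (residue_class n b)
          = emeasure M (residue_class n b)" .
    qed (simp_all add: sM)
    then have "emeasure M S = emeasure (distr M borel (\<lambda>x. x - a)) S" by simp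
    also have "\<dots> = emeasure M ((\<lambda>x. x - a) -` S)" using S by (simp add: emeasure_distr[OF m] sp)
    also have "(\<lambda>x. x - a) -` S = (\<lambda>x. a + x) ` S"
    proof
      show "(\<lambda>x. x - a) -` S \<subseteq> (\<lambda>x. a + x) ` S"
      proof
        fix x assume "x \<in> (\<lambda>x. x - a) -` S"
        then show "x \<in> (\<lambda>x. a + x) ` S" by (intro image_eqI[of _ _ "x - a"]) auto
      qed
    qed auto
    finally show ?thesis by simp
  qed
  have "normalized_haar M" unfolding normalized_haar_def using sM M1 inv by blast
  then show ?thesis by blast
qed

lemma normalized_haar_padic_haar: "normalized_haar (padic_haar :: 'p::prime_card padic_int measure)"
proof -
  have "M = N" if "normalized_haar M" "normalized_haar N" for M N :: "'p padic_int measure"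
    using that normalized_haar_residue_class[OF that(1)] normalized_haar_residue_class[OF that(2)]
    by (intro padic_measure_eqI) (auto simp: normalized_haar_def)
  then show ?thesis unfolding padic_haar_def using ex_normalized_haar by (metis theI)
qed


section \<open>Measure-preserving and ergodic maps\<close>

definition measure_preserving :: "('p::prime_card padic_int \<Rightarrow> 'p padic_int) \<Rightarrow> bool" where
  "measure_preserving f \<longleftrightarrow> f \<in> measurable padic_haar padic_haar \<and>
     (\<forall>S\<in>sets padic_haar. measure padic_haar (f -` S) = measure padic_haar S)"

definition ergodic :: "('p::prime_card padic_int \<Rightarrow> 'p padic_int) \<Rightarrow> bool" where
  "ergodic f \<longleftrightarrow> measure_preserving f \<and>
     (\<forall>S\<in>sets padic_haar. f -` S = S \<longrightarrow> measure padic_haar S \<in> {0, 1})"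


section \<open>The van der Put basis\<close>

definition vdp_floor_log :: "nat \<Rightarrow> nat \<Rightarrow> nat" where
  "vdp_floor_log p m = nat \<lfloor>log (real p) (real m)\<rfloor>"

text \<open>
  With s = \<open>vdp_floor_log p m\<close>, the leading base-p digit of m is \<open>m div p ^ s\<close>; the value at m = 0 is
  irrelevant.
\<close>

definition vdp_q :: "nat \<Rightarrow> nat \<Rightarrow> nat" where
  "vdp_q p m = m div p ^ vdp_floor_log p m * p ^ vdp_floor_log p m"

definition vdp_chi :: "nat \<Rightarrow> 'p::prime_card padic_int \<Rightarrow> 'p padic_int" where
  "vdp_chi m x =
     (if padic_abs (x - of_nat m) \<le> (if m = 0 then real CARD('p) powi (- 1)
          else real CARD('p) powi (- \<lfloor>log (real CARD('p)) (real m)\<rfloor> - 1))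
      then 1 else 0)"

end

theory Submission
  imports Defs
begin

text \<open>
  The increment \<open>d x = f x - x\<close> modulo \<open>p ^ (n + 1)\<close> depends only on \<open>x\<close> modulo \<open>p ^ n\<close>. Put
  \<open>D n = (\<Sum>a<p ^ n. d a)\<close>. If \<open>f\<close> is transitive modulo \<open>p ^ n\<close>, then modulo \<open>p ^ (n + 1)\<close> the iterate
  \<open>f ^^ (p ^ n)\<close> is the translation by \<open>D n\<close>, so \<open>f\<close> is transitive modulo \<open>p ^ (n + 1)\<close> as soon as
  \<open>D n\<close> is not divisible by \<open>p ^ (n + 1)\<close>. In terms of the van der Put coefficients,
  \<open>D (n + 1) = p * D n + (\<Sum>m\<in>{p ^ n..<p ^ (n + 1)}. B m - q m)\<close>, and the last sum vanishes modulo
  \<open>p ^ (n + 2)\<close>: the sum of the \<open>q m\<close> is \<open>p ^ (2 * n) * (p * (p - 1) / 2)\<close>, which is divisible by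
  \<open>p ^ (n + 2)\<close> except for \<open>p = 2\<close>, \<open>n = 1\<close>, where it is the 4 of condition (3). Hence
  \<open>D n\<close> is congruent to \<open>p ^ n * s\<close>. Transitivity modulo all powers of \<open>p\<close> gives ergodicity.
\<close>

section \<open>Arithmetic of congruences modulo powers of \<open>p\<close>\<close>

lemma padic_cong_iff_residue:
  fixes x y :: "'p::prime_card padic_int"
  shows "padic_cong x y k \<longleftrightarrow> residue x k = residue y k"
  by (simp add: padic_cong_def padic_power_dvd_iff residue_eq_iff)

lemma padic_cong_residue: "padic_cong x (of_nat (nat (residue x n)) :: 'p::prime_card padic_int) n"
  unfolding padic_cong_iff_residue residue_of_nat using residue_bounds[of x n] by simp

lemma nat_residue_less: "nat (residue (x :: 'p::prime_card padic_int) n) < CARD('p) ^ n"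
  using residue_bounds[of x n] by (simp add: nat_less_iff)

lemma padic_cong_trans [trans]: "padic_cong x y k \<Longrightarrow> padic_cong y z k \<Longrightarrow> padic_cong x z k"
  by (simp add: padic_cong_iff_residue)

lemma padic_cong_add:
  "padic_cong x y k \<Longrightarrow> padic_cong x' y' k \<Longrightarrow> padic_cong (x + x') (y + y') k"
  by (simp add: padic_cong_iff_residue residue_add)

lemma padic_cong_diff:
  "padic_cong x y k \<Longrightarrow> padic_cong x' y' k \<Longrightarrow> padic_cong (x - x') (y - y') k"
  by (simp add: padic_cong_iff_residue residue_diff)

lemma padic_cong_sum:
  "(\<And>i. i \<in> A \<Longrightarrow> padic_cong (g i) (h i) k) \<Longrightarrow> padic_cong (sum g A) (sum h A) k"
  by (simp add: padic_cong_def dvd_sum flip: sum_subtractf)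

text \<open>The gain of one power of \<open>p\<close> lets a congruence at precision
  \<open>n + 1\<close>, multiplied by \<open>p\<close>, serve at precision
  \<open>n + 2\<close>.\<close>

lemma padic_cong_mult_prime:
  fixes x y :: "'p::prime_card padic_int"
  assumes "padic_cong x y k"
  shows "padic_cong (of_nat CARD('p) * x) (of_nat CARD('p) * y) (Suc k)"
  using assms by (simp add: padic_cong_def mult_dvd_mono flip: right_diff_distrib)


section \<open>Transitivity modulo powers of p\<close>

text \<open>With \<open>b = c + N * e\<close> the condition on \<open>j\<close> becomes
  \<open>s * j = e\<close> modulo \<open>p\<close>, solvable because \<open>s\<close> is invertible
  there. This moves a point that is in the right class modulo \<open>p ^ n\<close> into a prescribed
  class modulo \<open>p ^ (n + 1)\<close>.\<close>

lemma add_mult_cover: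
  fixes b c N :: int and p s :: nat
  assumes "coprime p s" "p > 0" and "b mod N = c mod N"
  obtains j where "j < p" "(c + int j * (N * int s)) mod (N * int p) = b mod (N * int p)"
proof -
  obtain e where e: "b = c + N * e" using assms(3) by (metis mod_eqE add_diff_cancel_left' mult.commute)
  have "coprime (int s) (int p)" using assms(1) by (simp add: coprime_commute)
  then obtain t where t: "[int s * t = 1] (mod int p)" using cong_solve_coprime_int by blast
  define j where "j = nat ((t * e) mod int p)"
  have "j < p" using assms(2) by (simp add: j_def nat_less_iff)
  have "[int s * int j = e] (mod int p)"
  proof -
    have "[int s * int j = int s * (t * e)] (mod int p)"
      using assms(2) by (simp add: j_def cong_def mod_simps)
    also have "int s * (t * e) = (int s * t) * e" by simp
    also have "[(int s * t) * e = 1 * e] (mod int p)" by (rule cong_scalar_right[OF t])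
    finally show ?thesis by simp
  qed
  then have "int p dvd int s * int j - e" by (simp add: cong_iff_dvd_diff)
  moreover have "(c + int j * (N * int s)) - b = N * (int s * int j - e)"
    unfolding e by (simp add: algebra_simps)
  ultimately have "N * int p dvd (c + int j * (N * int s)) - b" by simp
  then show ?thesis using that \<open>j < p\<close> by (simp add: mod_eq_dvd_iff)
qed

lemma funpow_add_mult: "(f ^^ (i + N * j)) x = ((f ^^ N) ^^ j) ((f ^^ i) x)"
  by (metis add.commute comp_apply funpow_add funpow_mult)

text \<open>
  Along a full cycle modulo \<open>p\<^sup>n\<close> the increments \<open>f y - y\<close> add up to their sum over all residues
  modulo \<open>p\<^sup>n\<close>, so modulo \<open>p ^ (n + 1)\<close> the \<open>p\<^sup>n\<close>-th iterate is the translation by that sum.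
\<close>

lemma transitive_mod_power:
  fixes f :: "'p::prime_card padic_int \<Rightarrow> 'p padic_int"
  assumes incr: "\<And>n x y. padic_cong x y n \<Longrightarrow> padic_cong (f x - x) (f y - y) (Suc n)"
    and total: "\<And>n. padic_cong (\<Sum>a<CARD('p) ^ n. f (of_nat a) - of_nat a)
      (of_nat (CARD('p) ^ n * s)) (Suc n)"
    and s: "coprime CARD('p) s"
    and b: "0 \<le> b" "b < int CARD('p) ^ n"
  shows "\<exists>i<CARD('p) ^ n. residue ((f ^^ i) x) n = b"
  using b
proof (induction n arbitrary: b x)
  case 0
  then show ?case using residue_bounds[of x 0] by auto
next
  case (Suc n)
  let ?p = "CARD('p)"
  have p: "?p > 0" using prime_card_gt_1[where 'p='p] by simp
  \<comment> \<open>The start \<open>y\<close> is arbitrary so that the translation can be iterated;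
    this is why the induction generalises over \<open>x\<close>.\<close>
  have shift: "padic_cong ((f ^^ (?p ^ n)) y) (y + of_nat (?p ^ n * s)) (Suc n)" for y
  proof -
    define c where "c i = nat (residue ((f ^^ i) y) n)" for i
    have c: "c ` {..<?p ^ n} = {..<?p ^ n}"
    proof
      show "c ` {..<?p ^ n} \<subseteq> {..<?p ^ n}"
        by (auto simp: c_def nat_residue_less)
      show "{..<?p ^ n} \<subseteq> c ` {..<?p ^ n}"
      proof
        fix a assume "a \<in> {..<?p ^ n}"
        then have "int a < int ?p ^ n" by (metis lessThan_iff of_nat_less_iff of_nat_power)
        then obtain i where "i < ?p ^ n" "residue ((f ^^ i) y) n = int a" using Suc.IH[of "int a" y] by auto
        then show "a \<in> c ` {..<?p ^ n}" by (intro image_eqI[of _ _ i]) (auto simp: c_def)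
      qed
    qed
    \<comment> \<open>A map of a finite set onto itself is injective, so the sum along the orbit can
      be reindexed by residues.\<close>
    then have inj: "inj_on c {..<?p ^ n}" by (intro eq_card_imp_inj_on) auto
    have "(f ^^ (?p ^ n)) y - y = (\<Sum>i<?p ^ n. f ((f ^^ i) y) - (f ^^ i) y)"
      using sum_lessThan_telescope[of "\<lambda>i. (f ^^ i) y" "?p ^ n"] by simp
    also have "padic_cong \<dots> (\<Sum>i<?p ^ n. f (of_nat (c i)) - of_nat (c i)) (Suc n)"
      unfolding c_def by (intro padic_cong_sum incr padic_cong_residue)
    also have "(\<Sum>i<?p ^ n. f (of_nat (c i)) - of_nat (c i)) = (\<Sum>a<?p ^ n. f (of_nat a) - of_nat a)"
      using sum.reindex[OF inj, of "\<lambda>a. f (of_nat a) - of_nat a"] c by simp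
    also note total[of n]
    finally have "padic_cong ((f ^^ (?p ^ n)) y - y + y) (of_nat (?p ^ n * s) + y) (Suc n)"
      by (intro padic_cong_add) (simp_all add: padic_cong_iff_residue)
    then show ?thesis by (simp add: add.commute)
  qed
  have shifts: "padic_cong (((f ^^ (?p ^ n)) ^^ j) y) (y + of_nat (j * (?p ^ n * s))) (Suc n)" for j y
  proof (induction j)
    case 0
    then show ?case by (simp add: padic_cong_iff_residue)
  next
    case (Suc j)
    let ?z = "((f ^^ (?p ^ n)) ^^ j) y"
    have "((f ^^ (?p ^ n)) ^^ Suc j) y = (f ^^ (?p ^ n)) ?z" by simp
    also have "padic_cong \<dots> (?z + of_nat (?p ^ n * s)) (Suc n)" by (rule shift)
    also have "padic_cong (?z + of_nat (?p ^ n * s)) (y + of_nat (j * (?p ^ n * s)) + of_nat (?p ^ n * s)) (Suc n)"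
      by (intro padic_cong_add Suc) (simp add: padic_cong_iff_residue)
    also have "y + of_nat (j * (?p ^ n * s)) + of_nat (?p ^ n * s) = y + of_nat (Suc j * (?p ^ n * s))"
      by (simp add: algebra_simps)
    finally show ?case .
  qed
  \<comment> \<open>The induction hypothesis first reaches the class of \<open>b\<close> modulo
    \<open>p ^ n\<close>; then \<open>j\<close> rounds of \<open>p ^ n\<close> steps, each adding
    \<open>p ^ n * s\<close>, adjust the remaining digit.\<close>
  have "0 \<le> b mod int ?p ^ n" "b mod int ?p ^ n < int ?p ^ n" using p by simp_all
  then obtain i where i: "i < ?p ^ n" "residue ((f ^^ i) x) n = b mod int ?p ^ n"
    using Suc.IH by blast
  define y where "y = (f ^^ i) x"
  have "b mod int ?p ^ n = residue y (Suc n) mod int ?p ^ n"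
    using i(2) residue_mod[of n "Suc n" y] by (simp add: y_def)
  then obtain j where j: "j < ?p"
    "(residue y (Suc n) + int j * (int ?p ^ n * int s)) mod (int ?p ^ n * int ?p) = b mod (int ?p ^ n * int ?p)"
    using add_mult_cover[OF s p] by blast
  have "residue ((f ^^ (i + ?p ^ n * j)) x) (Suc n) = residue (y + of_nat (j * (?p ^ n * s))) (Suc n)"
    using shifts[of j y] by (simp add: funpow_add_mult y_def padic_cong_iff_residue)
  also have "\<dots> = (residue y (Suc n) + int j * (int ?p ^ n * int s)) mod int ?p ^ Suc n"
    unfolding residue_add residue_of_nat by (simp only: of_nat_mult of_nat_power mod_add_right_eq)
  also have "\<dots> = b" using j(2) Suc.prems by (simp add: mult.commute)
  finally have "residue ((f ^^ (i + ?p ^ n * j)) x) (Suc n) = b" .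
  moreover have "i + ?p ^ n * j < ?p ^ Suc n"
  proof -
    have "i + ?p ^ n * j < ?p ^ n * Suc j" using i(1) by simp
    also have "\<dots> \<le> ?p ^ n * ?p" using j(1) by (intro mult_le_mono2) simp
    finally show ?thesis by (simp add: mult.commute)
  qed
  ultimately show ?case by blast
qed


section \<open>Ergodicity from transitivity\<close>

lemma padic_haar_simps [simp]:
  "sets (padic_haar :: 'p::prime_card padic_int measure) = sets borel"
  "space (padic_haar :: 'p::prime_card padic_int measure) = UNIV"
  "emeasure (padic_haar :: 'p::prime_card padic_int measure) UNIV = 1"
proof -
  show s: "sets (padic_haar :: 'p padic_int measure) = sets borel"
    and "emeasure (padic_haar :: 'p padic_int measure) UNIV = 1"
    using normalized_haar_padic_haar[where 'p='p] by (auto simp: normalized_haar_def)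
  show "space (padic_haar :: 'p padic_int measure) = UNIV" using sets_eq_imp_space_eq[OF s] by simp
qed

lemma prob_space_padic_haar: "prob_space (padic_haar :: 'p::prime_card padic_int measure)"
  by (rule prob_spaceI) simp

text \<open>The map induced on residues modulo \<open>p ^ n\<close> is onto: each residue is reached
  by an iterate of \<open>f 0\<close>, which is \<open>f\<close> of an iterate of 0. Being onto a
  finite set, it is a bijection, so a class has only one class as preimage.\<close>

lemma vimage_residue_class:
  fixes f :: "'p::prime_card padic_int \<Rightarrow> 'p padic_int"
  assumes lip: "\<And>n x y. padic_cong x y n \<Longrightarrow> padic_cong (f x) (f y) n"
    and trans: "\<And>n b x. 0 \<le> b \<Longrightarrow> b < int CARD('p) ^ n \<Longrightarrow> \<exists>i. residue ((f ^^ i) x) n = b"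
  shows "f -` residue_class n (residue (f x) n) = residue_class n (residue x n)"
proof -
  let ?A = "{0..<int CARD('p) ^ n}"
  define g where "g b = residue (f (of_nat (nat b))) n" for b
  have g: "residue (f y) n = g (residue y n)" for y
    using lip[OF padic_cong_residue[of y n]] by (simp add: g_def padic_cong_iff_residue)
  have "?A \<subseteq> g ` ?A"
  proof
    fix b assume "b \<in> ?A"
    then obtain i where "residue ((f ^^ i) (f 0)) n = b" using trans by force
    then have "residue (f ((f ^^ i) 0)) n = b" by (simp add: funpow_swap1)
    then show "b \<in> g ` ?A" unfolding g using residue_bounds by force
  qed
  then have "inj_on g ?A"
    by (intro finite_surj_inj) auto
  then have "g (residue y n) = g (residue x n) \<longleftrightarrow> residue y n = residue x n"
    for y :: "'p padic_int"
    using inj_on_eq_iff[of g ?A "residue y n" "residue x n"] by (simp add: residue_bounds)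
  then show ?thesis by (simp add: residue_class_def g)
qed

text \<open>
  For an invariant set \<open>S\<close>, transitivity makes the measure of \<open>S \<inter> C\<close> the same for all residue classes
  \<open>C\<close> modulo \<open>p\<^sup>n\<close>. Hence \<open>A \<mapsto> \<mu> (S \<inter> A)\<close> is the multiple \<open>\<mu> S\<close> of the Haar measure, and \<open>A = S\<close> gives
  \<open>\<mu> S = (\<mu> S)\<^sup>2\<close>.
\<close>

lemma ergodic_if_transitive:
  fixes f :: "'p::prime_card padic_int \<Rightarrow> 'p padic_int"
  assumes lip: "\<And>n x y. padic_cong x y n \<Longrightarrow> padic_cong (f x) (f y) n"
    and trans: "\<And>n b x. 0 \<le> b \<Longrightarrow> b < int CARD('p) ^ n \<Longrightarrow> \<exists>i. residue ((f ^^ i) x) n = b"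
  shows "ergodic f"
proof -
  let ?H = "padic_haar :: 'p padic_int measure"
  let ?C = "residue_class :: nat \<Rightarrow> int \<Rightarrow> 'p padic_int set"
  interpret prob_space ?H by (rule prob_space_padic_haar)
  note vim = vimage_residue_class[of f, OF lip trans]
  have empty: "?C n b = {}" if "\<not> (0 \<le> b \<and> b < int CARD('p) ^ n)" for n b
    using that residue_bounds unfolding residue_class_def by blast
  \<comment> \<open>\<open>vim\<close> speaks only of classes that contain a value of
    \<open>f\<close>; by transitivity these are all the nonempty ones.\<close>
  have ex: "\<exists>x. residue (f x) n = b" if "0 \<le> b" "b < int CARD('p) ^ n" for n b
    using trans[OF that, of "f 0"] by (metis funpow_swap1)
  have Csets: "?C n b \<in> sets ?H" for n b by (simp add: sets_residue_class)
  have vsets: "f -` ?C n b \<in> sets borel" for n b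
  proof (cases "0 \<le> b \<and> b < int CARD('p) ^ n")
    case True
    then obtain x where "residue (f x) n = b" using ex by blast
    then show ?thesis using vim[of n x] sets_residue_class by metis
  qed (simp add: empty)
  have "f \<in> measurable ?H borel"
    using vsets by (intro measurable_sigma_sets[OF borel_padic_int]) auto
  then have meas: "f \<in> measurable ?H ?H" by (simp cong: measurable_cong_sets)
  have distr: "distr ?H ?H f = ?H"
  proof (rule padic_measure_eqI)
    fix n b assume b: "0 \<le> b" "b < int CARD('p) ^ n"
    then obtain x where x: "residue (f x) n = b" using ex by blast
    have "emeasure (distr ?H ?H f) (?C n b) = emeasure ?H (?C n (residue x n))"
      using vim[of n x] x by (simp add: emeasure_distr[OF meas] Csets[simplified])
    also have "\<dots> = emeasure ?H (?C n b)"
      using b by (simp add: normalized_haar_residue_class[OF normalized_haar_padic_haar] residue_bounds)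
    finally show "emeasure (distr ?H ?H f) (?C n b) = emeasure ?H (?C n b)" .
  qed (use meas in \<open>simp_all add: emeasure_distr\<close>)
  have pres: "emeasure ?H (f -` S) = emeasure ?H S" if "S \<in> sets ?H" for S
    using emeasure_distr[OF meas that] distr by simp
  then have mp: "measure_preserving f"
    using meas by (simp add: measure_preserving_def measure_def)
  have "measure ?H S \<in> {0, 1}" if S: "S \<in> sets ?H" and inv: "f -` S = S" for S
  proof -
    \<comment> \<open>By \<open>vim\<close> and invariance, the preimage of \<open>S\<close> cut
      with the class of \<open>f x\<close> is \<open>S\<close> cut with the class of
      \<open>x\<close>.\<close>
    have step: "emeasure ?H (S \<inter> ?C n (residue (f x) n)) = emeasure ?H (S \<inter> ?C n (residue x n))" for n x
      using pres[of "S \<inter> ?C n (residue (f x) n)"] S Csets inv vim[of n x] by (simp add: vimage_Int)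
    have iter: "emeasure ?H (S \<inter> ?C n (residue ((f ^^ i) 0) n)) = emeasure ?H (S \<inter> ?C n (residue 0 n))" for n i
      by (induction i) (simp_all add: step)
    have const: "emeasure ?H (S \<inter> ?C n b) = emeasure ?H (S \<inter> ?C n 0)"
      if "0 \<le> b" "b < int CARD('p) ^ n" for n b
      using trans[OF that, of 0] iter[of n] by auto
    have "density ?H (indicator S) = scale_measure (emeasure ?H S) ?H"
    proof (rule padic_measure_eqI)
      show "emeasure (density ?H (indicator S)) UNIV \<noteq> \<infinity>"
        using S by (simp add: emeasure_restricted)
      fix n b assume b: "0 \<le> b" "b < int CARD('p) ^ n"
      let ?N = "ennreal (real CARD('p) ^ n)"
      have Npos: "real CARD('p) ^ n > 0" using prime_card_gt_1[where 'p='p] by simp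
      have "emeasure ?H S = emeasure ?H (\<Union>c\<in>{0..<int CARD('p) ^ n}. S \<inter> ?C n c)"
        by (intro arg_cong[where f = "emeasure ?H"]) (auto simp: residue_class_def residue_bounds)
      also have "\<dots> = (\<Sum>c\<in>{0..<int CARD('p) ^ n}. emeasure ?H (S \<inter> ?C n c))"
        using S Csets by (intro sum_emeasure[symmetric]) (auto simp: disjoint_family_on_def residue_class_def)
      also have "\<dots> = (\<Sum>c\<in>{0..<int CARD('p) ^ n}. emeasure ?H (S \<inter> ?C n b))"
      proof (rule sum.cong[OF refl])
        fix c assume "c \<in> {0..<int CARD('p) ^ n}"
        then have "emeasure ?H (S \<inter> ?C n c) = emeasure ?H (S \<inter> ?C n 0)" by (intro const) simp_all
        then show "emeasure ?H (S \<inter> ?C n c) = emeasure ?H (S \<inter> ?C n b)" using const[OF b] by simp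
      qed
      also have "\<dots> = emeasure ?H (S \<inter> ?C n b) * ?N"
        by (simp add: nat_power_eq ennreal_of_nat_eq_real_of_nat mult.commute)
      finally have "emeasure ?H S / ?N = emeasure ?H (S \<inter> ?C n b)"
        using Npos by (simp add: ennreal_mult_divide_eq)
      then show "emeasure (density ?H (indicator S)) (?C n b)
          = emeasure (scale_measure (emeasure ?H S) ?H) (?C n b)"
        using S Csets b
        by (simp add: emeasure_restricted normalized_haar_residue_class[OF normalized_haar_padic_haar]
            ennreal_times_divide)
    qed (use S in simp_all)
    then have "emeasure ?H S = emeasure ?H S * emeasure ?H S"
      using S emeasure_restricted[OF S S] by simp
    then have "measure ?H S = measure ?H S * measure ?H S"
      by (simp add: emeasure_eq_measure flip: ennreal_mult)
    then show ?thesis by auto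
  qed
  with mp show ?thesis by (simp add: ergodic_def)
qed


section \<open>Van der Put coefficients\<close>

lemma vdp_floor_log_eq:
  fixes p l m :: nat
  assumes "p \<ge> 2" "p ^ l \<le> m" "m < p ^ Suc l"
  shows "\<lfloor>log (real p) (real m)\<rfloor> = int l" "vdp_floor_log p m = l"
proof -
  have "m > 0" using assms by (metis gr0I le_zero_eq not_numeral_le_zero power_eq_0_iff)
  then show "\<lfloor>log (real p) (real m)\<rfloor> = int l"
    using assms by (simp add: floor_log_nat_eq_powr_iff)
  then show "vdp_floor_log p m = l" by (simp add: vdp_floor_log_def)
qed

text \<open>The ball around \<open>m\<close> is its residue class modulo \<open>p ^ (l + 1)\<close>,
  where \<open>l\<close> is the position of the leading digit. The disjunct \<open>l = 0\<close>
  admits \<open>m = 0\<close>, whose radius \<open>1 / p\<close> is that of the other one-digit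
  numbers.\<close>

lemma vdp_chi_eq:
  fixes x :: "'p::prime_card padic_int"
  assumes "l = 0 \<or> CARD('p) ^ l \<le> m" "m < CARD('p) ^ Suc l"
  shows "vdp_chi m x = (if residue x (Suc l) = int m then 1 else 0)"
proof -
  have p: "CARD('p) \<ge> 2" using prime_card_gt_1[where 'p='p] by simp
  have "residue x (Suc l) = int m \<longleftrightarrow> residue x (Suc l) = residue (of_nat m :: 'p padic_int) (Suc l)"
    using assms(2) unfolding residue_of_nat
    by (metis mod_pos_pos_trivial of_nat_0_le_iff of_nat_less_iff of_nat_power)
  also have "\<dots> \<longleftrightarrow> padic_abs (x - of_nat m) \<le> real CARD('p) powi (- int (Suc l))"
    by (simp only: padic_abs_le_iff residue_eq_iff)
  finally have eq: "residue x (Suc l) = int m \<longleftrightarrow> padic_abs (x - of_nat m) \<le> real CARD('p) powi (- int (Suc l))" .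
  show ?thesis
  proof (cases "m = 0")
    case True
    then have "l = 0" using assms(1) p by auto
    then show ?thesis using True eq by (simp add: vdp_chi_def)
  next
    case False
    have "\<lfloor>log (real CARD('p)) (real m)\<rfloor> = int l"
      using False assms p by (intro vdp_floor_log_eq) auto
    then have e: "- \<lfloor>log (real CARD('p)) (real m)\<rfloor> - 1 = - int (Suc l)" by simp
    show ?thesis unfolding vdp_chi_def e eq using False by simp
  qed
qed

lemma vdp_level:
  fixes p m :: nat
  assumes "p \<ge> 2"
  obtains l where "l = 0 \<or> p ^ l \<le> m" "m < p ^ Suc l"
proof (cases "m = 0")
  case False
  then show ?thesis using ex_power_ivl1[of p m] assms that by auto
qed (use assms that[of 0] in auto)

lemma residue_of_nat_less:
  assumes "m < CARD('p) ^ n"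
  shows "residue (of_nat m :: 'p::prime_card padic_int) n = int m"
  using assms by (metis mod_pos_pos_trivial of_nat_0_le_iff of_nat_less_iff of_nat_power residue_of_nat)

text \<open>The modulus belonging to \<open>k\<close> exceeds \<open>m\<close>, so the residue of
  \<open>m\<close> is \<open>m\<close> itself and differs from \<open>k\<close>. Hence the expansion
  at a natural number is a finite sum.\<close>

lemma vdp_chi_of_nat_eq_0:
  assumes "m < k"
  shows "vdp_chi k (of_nat m :: 'p::prime_card padic_int) = 0"
proof -
  have "CARD('p) \<ge> 2" using prime_card_gt_1[where 'p='p] by simp
  then obtain l where l: "l = 0 \<or> CARD('p) ^ l \<le> k" "k < CARD('p) ^ Suc l" by (rule vdp_level)
  then have "residue (of_nat m :: 'p padic_int) (Suc l) = int m"
    using assms by (intro residue_of_nat_less) simp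
  then show ?thesis using l assms by (simp only: vdp_chi_eq[OF l]) simp
qed

lemma vdp_of_nat:
  fixes f :: "'p::prime_card padic_int \<Rightarrow> 'p padic_int"
  assumes "\<And>x. (\<lambda>m. B m * vdp_chi m x) sums f x" "m \<le> M"
  shows "f (of_nat m) = (\<Sum>k\<le>M. B k * vdp_chi k (of_nat m))"
proof (rule sums_unique2[OF assms(1)])
  show "(\<lambda>k. B k * vdp_chi k (of_nat m)) sums (\<Sum>k\<le>M. B k * vdp_chi k (of_nat m))"
    using assms(2) by (intro sums_finite) (auto simp: vdp_chi_of_nat_eq_0)
qed

lemma vdp_coeff_small:
  fixes f :: "'p::prime_card padic_int \<Rightarrow> 'p padic_int"
  assumes "\<And>x. (\<lambda>m. B m * vdp_chi m x) sums f x" "m < CARD('p)"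
  shows "f (of_nat m) = B m"
proof -
  have "f (of_nat m) = (\<Sum>k\<le>m. B k * vdp_chi k (of_nat m))"
    using assms(1) by (rule vdp_of_nat) simp
  also have "\<dots> = (\<Sum>k\<le>m. if k = m then B k else 0)"
  proof (rule sum.cong[OF refl])
    fix k assume "k \<in> {..m}"
    then have "k < CARD('p) ^ Suc 0" using assms(2) by simp
    moreover have "residue (of_nat m :: 'p padic_int) (Suc 0) = int m"
      using assms(2) by (intro residue_of_nat_less) simp
    ultimately show "B k * vdp_chi k (of_nat m) = (if k = m then B k else 0)"
      by (simp add: vdp_chi_eq[of 0])
  qed
  finally show ?thesis by simp
qed

text \<open>Dropping the leading digit of \<open>m\<close> is invisible to \<open>vdp_chi k\<close>
  when \<open>k\<close> has at most \<open>n\<close> digits, since its modulus divides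
  \<open>p ^ n\<close>. For longer \<open>k \<le> m\<close> both arguments are their own residues,
  and only \<open>k = m\<close> contributes.\<close>

lemma vdp_coeff_diff:
  fixes f :: "'p::prime_card padic_int \<Rightarrow> 'p padic_int"
  assumes sums: "\<And>x. (\<lambda>m. B m * vdp_chi m x) sums f x"
    and n: "n > 0" and m: "CARD('p) ^ n \<le> m" "m < CARD('p) ^ Suc n"
  shows "f (of_nat m) - f (of_nat (m mod CARD('p) ^ n)) = B m"
proof -
  let ?p = "CARD('p)"
  let ?r = "m mod ?p ^ n"
  have p: "?p \<ge> 2" using prime_card_gt_1[where 'p='p] by simp
  have r: "?r < ?p ^ n" using p by simp
  have chi: "vdp_chi k (of_nat m :: 'p padic_int) - vdp_chi k (of_nat ?r) = (if k = m then 1 else 0)"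
    if "k \<le> m" for k
  proof -
    obtain l where l: "l = 0 \<or> ?p ^ l \<le> k" "k < ?p ^ Suc l" using p by (rule vdp_level)
    show ?thesis
    proof (cases "l < n")
      case True
      then have "?p ^ Suc l \<le> ?p ^ n" using p by (intro power_increasing) auto
      then have "k \<noteq> m" using l m by simp
      have "int ?p ^ Suc l dvd int ?p ^ n" using True by (intro le_imp_power_dvd) simp
      then have "residue (of_nat m :: 'p padic_int) (Suc l) = residue (of_nat ?r :: 'p padic_int) (Suc l)"
        unfolding residue_of_nat zmod_int of_nat_power by (simp only: mod_mod_cancel)
      then show ?thesis using \<open>k \<noteq> m\<close> by (simp only: vdp_chi_eq[OF l]) simp
    next
      case False
      then have "?p ^ n \<le> ?p ^ l" "?p ^ Suc n \<le> ?p ^ Suc l" using p by (auto intro: power_increasing)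
      moreover have "?p ^ l \<le> k" using l False n by auto
      ultimately have "?r < k" "?r < ?p ^ Suc l" "m < ?p ^ Suc l" using r m l by linarith+
      then show ?thesis by (simp only: vdp_chi_eq[OF l] residue_of_nat_less) auto
    qed
  qed
  have "f (of_nat m) = (\<Sum>k\<le>m. B k * vdp_chi k (of_nat m))"
    using sums by (rule vdp_of_nat) simp
  \<comment> \<open>The cutoff is \<open>m\<close> rather than \<open>?r\<close>, so that the two
    sums subtract termwise.\<close>
  moreover have "f (of_nat ?r) = (\<Sum>k\<le>m. B k * vdp_chi k (of_nat ?r))"
    using sums by (rule vdp_of_nat) simp
  ultimately have "f (of_nat m) - f (of_nat ?r)
      = (\<Sum>k\<le>m. B k * (vdp_chi k (of_nat m) - vdp_chi k (of_nat ?r)))"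
    by (simp add: right_diff_distrib sum_subtractf)
  also have "\<dots> = (\<Sum>k\<le>m. if k = m then B k else 0)"
    by (rule sum.cong) (auto simp: chi)
  finally show ?thesis by simp
qed

section \<open>Sums below a power of \<open>p\<close>, split by leading digit\<close>

text \<open>As \<open>m\<close> runs below \<open>p ^ (n + 1)\<close>, the truncation
  \<open>m mod p ^ n\<close> takes each value below \<open>p ^ n\<close> exactly \<open>p\<close>
  times, and it equals \<open>m\<close> when \<open>m < p ^ n\<close>.\<close>

lemma sum_power_Suc_split:
  fixes g :: "nat \<Rightarrow> 'a::comm_ring_1"
  assumes "p > 0"
  shows "(\<Sum>m<p ^ Suc n. g m) = of_nat p * (\<Sum>m<p ^ n. g m) +
    (\<Sum>m\<in>{p ^ n..<p ^ Suc n}. g m - g (m mod p ^ n))"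
proof -
  have block: "(\<Sum>m<p * p ^ n. g (m mod p ^ n)) = of_nat p * (\<Sum>m<p ^ n. g m)"
  proof -
    have "(\<Sum>m\<in>{c * p ^ n..<c * p ^ n + p ^ n}. g (m mod p ^ n)) = (\<Sum>m<p ^ n. g m)" for c
      using sum.shift_bounds_nat_ivl[of "\<lambda>m. g (m mod p ^ n)" 0 "c * p ^ n" "p ^ n"]
      by (simp add: add.commute atLeast0LessThan)
    then show ?thesis by (simp flip: sum.nat_group)
  qed
  have "p ^ n \<le> p ^ Suc n" using assms by simp
  then have "(\<Sum>m<p ^ Suc n. g m - g (m mod p ^ n)) = (\<Sum>m<p ^ n. g m - g (m mod p ^ n)) +
      (\<Sum>m\<in>{p ^ n..<p ^ Suc n}. g m - g (m mod p ^ n))"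
    using sum.atLeastLessThan_concat[of 0 "p ^ n" "p ^ Suc n" "\<lambda>m. g m - g (m mod p ^ n)"]
    by (simp add: atLeast0LessThan)
  also have "(\<Sum>m<p ^ n. g m - g (m mod p ^ n)) = 0" by simp
  finally show ?thesis using block by (simp add: sum_subtractf algebra_simps)
qed

text \<open>On the block of length \<open>p ^ n\<close> starting at \<open>c * p ^ n\<close> the
  quotient is constantly \<open>c\<close>, which leaves the sum of the digits
  \<open>c < p\<close>.\<close>

lemma sum_leading_parts:
  fixes p n :: nat
  shows "(\<Sum>m<p ^ Suc n. m div p ^ n * p ^ n) = p ^ (2 * n) * (p * (p - 1) div 2)"
proof -
  have "(\<Sum>m<p * p ^ n. m div p ^ n * p ^ n)
      = (\<Sum>c<p. \<Sum>m\<in>{c * p ^ n..<c * p ^ n + p ^ n}. m div p ^ n * p ^ n)"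
    by (simp add: sum.nat_group)
  also have "\<dots> = (\<Sum>c<p. \<Sum>m\<in>{c * p ^ n..<c * p ^ n + p ^ n}. c * p ^ n)"
  proof (intro sum.cong refl)
    fix c m assume "m \<in> {c * p ^ n..<c * p ^ n + p ^ n}"
    then have "m div p ^ n = c" by (intro div_nat_eqI) (auto simp: algebra_simps)
    then show "m div p ^ n * p ^ n = c * p ^ n" by simp
  qed
  also have "\<dots> = p ^ (2 * n) * (\<Sum>c<p. c)"
    unfolding mult_2 power_add by (simp add: sum_distrib_left mult_ac)
  also have "(\<Sum>c<p. c) = p * (p - 1) div 2"
    using Sum_Ico_nat[of 0 p] by (simp add: atLeast0LessThan)
  finally show ?thesis by simp
qed

theorem theorem3p8:
  fixes f :: "'p::prime_card padic_int \<Rightarrow> 'p padic_int"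
    and B :: "nat \<Rightarrow> 'p padic_int"
    and p s :: nat
  assumes p_def: "p = CARD('p)"
    and van_der_Put: "\<And>x. (\<lambda>m. B m * vdp_chi m x) sums f x"
    and Lipschitz: "1-lipschitz_on UNIV f"
    and s: "0 < s" "s < p"
    and c1: "padic_cong (B 0) (of_nat s) 1"
    and c2: "padic_cong (\<Sum>m = 0..p - 1. B m) (of_nat (p * s + (p - 1) * p div 2)) 2"
    and c3_even: "p = 2 \<Longrightarrow> padic_cong (\<Sum>m = p..p ^ 2 - 1. B m) 4 3"
    and c3_odd: "p > 2 \<Longrightarrow> padic_cong (\<Sum>m = p..p ^ 2 - 1. B m) 0 3"
    and c4: "\<And>m. m \<ge> p \<Longrightarrow> padic_cong (B m) (of_nat (vdp_q p m)) (vdp_floor_log p m + 1)"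
    and c5: "\<And>n. n \<ge> 3 \<Longrightarrow> padic_cong (\<Sum>m = p ^ (n - 1)..p ^ n - 1. B m) 0 (n + 1)"
    and c6: "\<And>m. 0 < m \<Longrightarrow> m < p \<Longrightarrow> padic_cong (B m) (B 0 + of_nat m) 1"
  shows "ergodic f"
proof -
  have p2: "p \<ge> 2" using prime_card_gt_1[where 'p='p] by (simp add: p_def)
  have prime: "prime p" unfolding p_def by (rule prime_card)
  have lip: "padic_cong (f x) (f y) n" if "padic_cong x y n" for n x y
  proof -
    have "padic_abs (f x - f y) \<le> padic_abs (x - y)"
      using lipschitz_onD[OF Lipschitz, of x y] by (simp add: dist_padic_int_def)
    moreover have "padic_abs (x - y) \<le> real CARD('p) powi (- int n)"
      using that by (simp add: padic_abs_le_iff padic_cong_iff_residue residue_eq_iff)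
    ultimately show ?thesis
      using padic_abs_le_iff[of "f x - f y" n]
      by (auto simp: padic_cong_iff_residue residue_eq_iff[of "f x"])
  qed
  define d :: "'p padic_int \<Rightarrow> 'p padic_int" where "d x = f x - x" for x
  have small: "f (of_nat m) = B m" if "m < p" for m
    using vdp_coeff_small[OF van_der_Put] that by (simp add: p_def)
  have coeff: "d (of_nat m) - d (of_nat (m mod p ^ n)) = B m - of_nat (m div p ^ n * p ^ n)"
    if "n > 0" "p ^ n \<le> m" "m < p ^ Suc n" for m n
  proof -
    have "f (of_nat m) - f (of_nat (m mod p ^ n)) = B m"
      using vdp_coeff_diff[OF van_der_Put] that by (simp add: p_def)
    moreover have "of_nat m = (of_nat (m div p ^ n * p ^ n) + of_nat (m mod p ^ n) :: 'p padic_int)"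
      by (simp only: div_mult_mod_eq flip: of_nat_add)
    ultimately show ?thesis by (simp add: d_def algebra_simps)
  qed
  \<comment> \<open>For \<open>n = 0\<close> the truncation is 0 and the claim comes from
    \<open>c6\<close>; for \<open>n > 0\<close> it comes from \<open>c4\<close>, since
    \<open>m div p ^ n * p ^ n\<close> is then \<open>vdp_q p m\<close>.\<close>
  have digit: "padic_cong (d (of_nat m)) (d (of_nat (m mod p ^ n))) (Suc n)" if m: "m < p ^ Suc n" for m n
  proof (cases "m < p ^ n")
    case True
    then show ?thesis by (simp add: padic_cong_iff_residue)
  next
    case False
    show ?thesis
    proof (cases "n = 0")
      case True
      then have "padic_cong (B m - of_nat m) (B 0 + of_nat m - of_nat m) 1"
        using False m by (intro padic_cong_diff c6) (auto simp: padic_cong_iff_residue)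
      then show ?thesis using True m p2 small[of m] small[of 0] by (simp add: d_def)
    next
      case n: False
      have "p ^ 1 \<le> p ^ n" using n p2 by (intro power_increasing) auto
      then have "p \<le> m" using False by simp
      have log: "vdp_floor_log p m = n" using False m p2 by (intro vdp_floor_log_eq) auto
      have "padic_cong (B m) (of_nat (m div p ^ n * p ^ n)) (Suc n)"
        using c4[OF \<open>p \<le> m\<close>] unfolding vdp_q_def log by simp
      then show ?thesis using coeff[of n m] n False m by (simp add: padic_cong_def)
    qed
  qed
  have incr: "padic_cong (d x) (d y) (Suc n)" if "padic_cong x y n" for x y n
  proof -
    \<comment> \<open>The Lipschitz condition replaces \<open>z\<close> by its representative below
      \<open>p ^ (n + 1)\<close>; then \<open>digit\<close> strips the top digit.\<close>
    have "padic_cong (d z) (d (of_nat (nat (residue z n)))) (Suc n)" for z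
    proof -
      let ?m = "nat (residue z (Suc n))"
      have "residue z (Suc n) < int p ^ Suc n" unfolding p_def by (rule residue_bounds)
      then have m: "?m < p ^ Suc n" by (metis nat_less_iff residue_bounds(1) of_nat_power)
      have "padic_cong (d z) (d (of_nat ?m)) (Suc n)"
        unfolding d_def by (intro padic_cong_diff lip padic_cong_residue)
      also have "padic_cong (d (of_nat ?m)) (d (of_nat (?m mod p ^ n))) (Suc n)" using m by (rule digit)
      also have "?m mod p ^ n = nat (residue z n)"
        using residue_mod[of n "Suc n" z] residue_bounds(1)[of z "Suc n"]
          nat_mod_distrib[of "residue z (Suc n)" "int (p ^ n)"]
        by (simp add: p_def nat_power_eq)
      finally show ?thesis .
    qed
    from this[of x] this[of y] show ?thesis using that by (simp add: padic_cong_iff_residue)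
  qed
  have level: "padic_cong (\<Sum>m\<in>{p ^ n..<p ^ Suc n}. B m)
      (of_nat (p ^ (2 * n) * (p * (p - 1) div 2))) (Suc (Suc n))" if "n > 0" for n
  proof -
    have ivl: "{p ^ n..p ^ Suc n - 1} = {p ^ n..<p ^ Suc n}"
      using atLeastLessThanSuc_atLeastAtMost[of "p ^ n" "p ^ Suc n - 1"] p2 by simp
    have "p = 2 \<or> p > 2" "n = 1 \<or> n \<ge> 2" using p2 that by auto
    then consider "p = 2" "n = 1" | "p > 2" "n = 1" | "n \<ge> 2" by blast
    then show ?thesis
    proof cases
      case 1
      then have e: "Suc (Suc n) = 3" by simp
      show ?thesis unfolding ivl[symmetric] e using c3_even 1 by simp
    next
      case n2: 2
      \<comment> \<open>Oddness lets a factor \<open>p\<close> out of the division by 2, which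
        supplies the third power of \<open>p\<close>.\<close>
      have "odd p" using prime prime_odd_nat n2 by blast
      then have "p * (p - 1) div 2 = p * ((p - 1) div 2)" by (simp add: div_mult_swap)
      then have "p ^ (2 * n) * (p * (p - 1) div 2) = p ^ 3 * ((p - 1) div 2)"
        using n2 by (simp add: power3_eq_cube power2_eq_square)
      moreover have "padic_cong (\<Sum>m\<in>{p ^ n..<p ^ Suc n}. B m) 0 3"
        unfolding ivl[symmetric] using c3_odd n2 by (simp add: power2_eq_square)
      ultimately show ?thesis using n2
        by (simp add: padic_cong_iff_residue residue_mult residue_of_nat p_def numeral_3_eq_3 flip: of_nat_power)
    next
      case 3
      \<comment> \<open>Here \<open>2 * n \<ge> n + 2\<close>; this fails for \<open>n = 1\<close>,
        hence the two separate cases above.\<close>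
      have "p ^ Suc (Suc n) dvd p ^ (2 * n)" using 3 by (intro le_imp_power_dvd) simp
      then have "p ^ Suc (Suc n) dvd p ^ (2 * n) * (p * (p - 1) div 2)" by simp
      then have "residue (of_nat (p ^ (2 * n) * (p * (p - 1) div 2)) :: 'p padic_int) (Suc (Suc n)) = 0"
        unfolding residue_of_nat by (metis mod_eq_0_iff_dvd of_nat_dvd_iff of_nat_power p_def)
      moreover have "padic_cong (\<Sum>m\<in>{p ^ n..<p ^ Suc n}. B m) 0 (Suc (Suc n))"
        using c5[of "Suc n"] 3 ivl by simp
      ultimately show ?thesis by (simp add: padic_cong_iff_residue)
    qed
  qed
  have total: "padic_cong (\<Sum>a<p ^ n. d (of_nat a)) (of_nat (p ^ n * s)) (Suc n)" for n
  proof (induction n)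
    case 0
    then show ?case using c1 small[of 0] p2 by (simp add: d_def lessThan_Suc)
  next
    case (Suc n)
    \<comment> \<open>The passage from 0 to 1 is \<open>c2\<close> with the sum of all
      \<open>a < p\<close> subtracted; \<open>level\<close> covers only
      \<open>n > 0\<close>.\<close>
    show ?case
    proof (cases "n = 0")
      case True
      have "{0..p - 1} = {..<p}" using p2 by auto
      then have "(\<Sum>a<p. d (of_nat a)) = (\<Sum>m = 0..p - 1. B m) - of_nat (\<Sum>a<p. a)"
        by (simp add: d_def sum_subtractf small)
      also have "(\<Sum>a<p. a) = (p - 1) * p div 2"
        using Sum_Ico_nat[of 0 p] by (simp add: atLeast0LessThan mult.commute)
      also have "padic_cong ((\<Sum>m = 0..p - 1. B m) - of_nat ((p - 1) * p div 2))
          (of_nat (p * s + (p - 1) * p div 2) - of_nat ((p - 1) * p div 2)) 2"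
        by (intro padic_cong_diff c2) (simp add: padic_cong_iff_residue)
      finally show ?thesis using True by (simp add: numeral_2_eq_2)
    next
      case False
      let ?I = "{p ^ n..<p ^ Suc n}" and ?V = "p ^ (2 * n) * (p * (p - 1) div 2)"
      \<comment> \<open>\<open>sum_leading_parts\<close> starts at 0, but its terms with
        \<open>m < p ^ n\<close> have quotient 0.\<close>
      have V: "?V = (\<Sum>m\<in>?I. m div p ^ n * p ^ n)"
        unfolding sum_leading_parts[symmetric]
        using p2 by (intro sum.mono_neutral_right) (auto simp: not_le)
      have "(\<Sum>m\<in>?I. d (of_nat m) - d (of_nat (m mod p ^ n))) = (\<Sum>m\<in>?I. B m - of_nat (m div p ^ n * p ^ n))"
        using coeff[of n] False by (intro sum.cong) auto
      also have "\<dots> = (\<Sum>m\<in>?I. B m) - of_nat ?V"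
        unfolding V by (simp only: of_nat_sum sum_subtractf)
      finally have "(\<Sum>a<p ^ Suc n. d (of_nat a))
          = of_nat CARD('p) * (\<Sum>a<p ^ n. d (of_nat a)) + ((\<Sum>m\<in>?I. B m) - of_nat ?V)"
        using sum_power_Suc_split[of p "\<lambda>a. d (of_nat a)" n] p2 by (simp only: p_def)
      also have "padic_cong \<dots> (of_nat CARD('p) * of_nat (p ^ n * s) + (of_nat ?V - of_nat ?V)) (Suc (Suc n))"
        using False
        by (intro padic_cong_add padic_cong_mult_prime padic_cong_diff Suc level)
          (simp_all add: padic_cong_iff_residue)
      also have "of_nat CARD('p) * of_nat (p ^ n * s) + (of_nat ?V - of_nat ?V)
          = (of_nat (p ^ Suc n * s) :: 'p padic_int)"
        by (simp add: p_def)
      finally show ?thesis .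
    qed
  qed
  have "coprime p s" using prime s prime_imp_coprime nat_dvd_not_less by blast
  then show ?thesis
    using transitive_mod_power[of f s] incr total unfolding d_def p_def
    by (intro ergodic_if_transitive lip) blast+
qed

end
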